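(* Let $\mathcal{K}$ be the Koopman operator on $\mathcal{H}=L^2(\Omega,\omega)$ and let $\{\mathcal{K}_n\}_{n\in\mathbb{N}}$ be operators on finite-dimensional Hilbert spaces $\{\mathcal{H}_n\}_{n\in\mathbb{N}}$, where $\mathcal{H}$ and all $\mathcal{H}_n$ are closed subspaces of a Hilbert space $\mathcal{X}$ with orthogonal projections $\mathcal{P}:\mathcal{X}\to\mathcal{H}$ and $\mathcal{P}_n:\mathcal{X}\to\mathcal{H}_n$ such that $\mathcal{P}_n^*\mathcal{P}_n$ converges strongly to $\mathcal{P}^*\mathcal{P}$ on $\mathcal{X}$ as $n\to\infty$. Suppose that $\mathcal{K}$ and all $\mathcal{K}_n$ are unitary and that $\mathcal{K}_n\mathcal{P}_n$ converges weakly to $\mathcal{K}\mathcal{P}$, i.e. $\lim_{n\to\infty}\langle \mathcal{K}_n\mathcal{P}_n v,w\rangle=\langle \mathcal{K}\mathcal{P} v,w\rangle$ for all $v,w\in\mathcal{X}$. Then, as $n\to\infty$, for every $g\in\mathcal{H}$ with $\|g\|=1$ the spectral measures $\xi_{g,n}$ converge weakly to $\xi_g$, and the projection-valued spectral measures $\mathcal{E}_n$ converge in the functional calculus sense to $\mathcal{E}$.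
   Context: Koopman operator: $\Omega\subset\mathbb{R}^d$, $\omega$ is a positive measure on $\Omega$, $\mathbf{F}:\Omega\to\Omega$ is a map, and $\mathcal{K}:L^2(\Omega,\omega)\to L^2(\Omega,\omega)$ is $[\mathcal{K}g](\mathbf{x})=g(\mathbf{F}(\mathbf{x}))$. It is assumed throughout that $\mathcal{K}$ is unitary. Subspaces: elements of $\mathcal{H}$ and $\mathcal{H}_n$ are regarded as elements of $\mathcal{X}$, so $\mathcal{P}^*$ and $\mathcal{P}_n^*$ are the inclusions into $\mathcal{X}$, and $\mathcal{K}\mathcal{P}$, $\mathcal{K}_n\mathcal{P}_n$ are regarded as operators $\mathcal{X}\to\mathcal{X}$. Each $\mathcal{K}_n$ is unitary on $\mathcal{H}_n$. Spectral measures: let $\mathbb{T}=\{z\in\mathbb{C}:|z|=1\}$ and let $[-\pi,\pi]_{\mathrm{per}}$ be the interval with endpoints identified, which is identified with $\mathbb{T}$ via $\lambda=e^{i\theta}$. $\mathcal{E}$ and $\mathcal{E}_n$ are the projection-valued spectral measures of the unitary operators $\mathcal{K}$ and $\mathcal{K}_n$, viewed as measures on $[-\pi,\pi]_{\mathrm{per}}$ via this change of variables, so that $\mathcal{K}=\int_{[-\pi,\pi]_{\mathrm{per}}}e^{i\theta}\,\mathrm{d}\mathcal{E}(\theta)$ and similarly for $\mathcal{K}_n$. For $g\in\mathcal{H}$ with $\|g\|=1$, $\xi_g(S)=\langle\mathcal{E}(S)g,g\rangle$ for Borel $S\subset[-\pi,\pi]_{\mathrm{per}}$, and $\xi_{g,n}$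 is the scalar-valued spectral measure of $\mathcal{K}_n$ with respect to $\mathcal{P}_ng/\|\mathcal{P}_ng\|$, i.e. $\xi_{g,n}(S)=\langle\mathcal{E}_n(S)\mathcal{P}_ng,\mathcal{P}_ng\rangle/\|\mathcal{P}_ng\|^2$, where it is assumed that $\mathcal{P}_ng\neq0$ (this holds for all sufficiently large $n$, and only such $n$ are considered). Weak convergence of measures: Borel measures $\beta_n$ on $[-\pi,\pi]_{\mathrm{per}}$ converge weakly to a Borel measure $\beta$ if $\lim_{n\to\infty}\int\phi\,\mathrm{d}\beta_n=\int\phi\,\mathrm{d}\beta$ for all continuous $\phi:[-\pi,\pi]_{\mathrm{per}}\to\mathbb{C}$. Functional calculus convergence: $\mathcal{E}_n$ converges in the functional calculus sense to $\mathcal{E}$ if for every $g\in\mathcal{H}$ and every continuous $\phi:[-\pi,\pi]_{\mathrm{per}}\to\mathbb{C}$, $$\lim_{n\to\infty}\int_{[-\pi,\pi]_{\mathrm{per}}}\phi(\varphi)\,\mathrm{d}\mathcal{E}_n(\varphi)\,\mathcal{P}_ng=\int_{[-\pi,\pi]_{\mathrm{per}}}\phi(\varphi)\,\mathrm{d}\mathcal{E}(\varphi)\,g,$$ with convergence in the norm of $\mathcal{X}$. *)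

theory Defs
  imports "HOL-Analysis.Analysis"
begin

section \<open>Complex Hilbert spaces\<close>

class scaleC =
  fixes scaleC :: "complex \<Rightarrow> 'a \<Rightarrow> 'a" (infixr "*\<^sub>C" 75)

text \<open>The inner product is linear in its first argument. Positivity and definiteness need no
  axioms of their own: they follow from \<open>norm_eq_sqrt_cinner\<close> and the axioms of a norm, as
  \<^const>\<open>sqrt\<close> is negative on negative reals.\<close>

class complex_inner = real_normed_vector + scaleC +
  fixes cinner :: "'a \<Rightarrow> 'a \<Rightarrow> complex"
  assumes scaleC_add_right: "a *\<^sub>C (x + y) = a *\<^sub>C x + a *\<^sub>C y"
    and scaleC_add_left: "(a + b) *\<^sub>C x = a *\<^sub>C x + b *\<^sub>C x"
    and scaleC_scaleC: "a *\<^sub>C b *\<^sub>C x = (a * b) *\<^sub>C x"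
    and scaleC_one: "1 *\<^sub>C x = x"
    and scaleR_scaleC: "r *\<^sub>R x = complex_of_real r *\<^sub>C x"
    and cinner_commute: "cinner x y = cnj (cinner y x)"
    and cinner_add_left: "cinner (x + y) z = cinner x z + cinner y z"
    and cinner_scaleC_left: "cinner (a *\<^sub>C x) y = a * cinner x y"
    and norm_eq_sqrt_cinner: "norm x = sqrt (Re (cinner x x))"

class complex_hilbert_space = complex_inner + complete_space

global_interpretation complex_vector:
  vector_space "scaleC :: complex \<Rightarrow> 'a \<Rightarrow> 'a::complex_inner"
  defines csubspace = complex_vector.subspace
    and cspan = complex_vector.span
  by unfold_locales
    (simp_all add: scaleC_add_right scaleC_add_left scaleC_scaleC scaleC_one)

definition closed_csubspace :: "'x::complex_inner set \<Rightarrow> bool" where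
  "closed_csubspace H \<longleftrightarrow> csubspace H \<and> closed H"

definition finite_dimensional :: "'x::complex_inner set \<Rightarrow> bool" where
  "finite_dimensional H \<longleftrightarrow> (\<exists>B. finite B \<and> H = cspan B)"

text \<open>An operator on a subspace \<open>H\<close> is a function on the whole type of which only the values on
  \<open>H\<close> matter.\<close>

definition clinear_operator_on :: "'x::complex_inner set \<Rightarrow> ('x \<Rightarrow> 'x) \<Rightarrow> bool" where
  "clinear_operator_on H U \<longleftrightarrow>
     (\<forall>x\<in>H. U x \<in> H) \<and>
     (\<forall>x\<in>H. \<forall>y\<in>H. U (x + y) = U x + U y) \<and>
     (\<forall>a. \<forall>x\<in>H. U (a *\<^sub>C x) = a *\<^sub>C U x)"

text \<open>\<open>U\<^sup>*U = UU\<^sup>* = 1\<close> on \<open>H\<close>, with \<open>V\<close> in the role of \<open>U\<^sup>*\<close>.\<close>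

definition unitary_on :: "'x::complex_inner set \<Rightarrow> ('x \<Rightarrow> 'x) \<Rightarrow> bool" where
  "unitary_on H U \<longleftrightarrow>
     clinear_operator_on H U \<and>
     (\<exists>V. clinear_operator_on H V \<and>
        (\<forall>x\<in>H. \<forall>y\<in>H. cinner (U x) y = cinner x (V y)) \<and>
        (\<forall>x\<in>H. V (U x) = x \<and> U (V x) = x))"

definition orthogonal_projection :: "'x::complex_inner set \<Rightarrow> ('x \<Rightarrow> 'x) \<Rightarrow> bool" where
  "orthogonal_projection H P \<longleftrightarrow>
     (\<forall>v. P v \<in> H \<and> (\<forall>w\<in>H. cinner (v - P v) w = 0))"


section \<open>The space \<open>L\<^sup>2\<close> and the Koopman operator\<close>

definition square_integrable :: "'a measure \<Rightarrow> ('a \<Rightarrow> complex) set" where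
  "square_integrable \<omega> =
     {f \<in> borel_measurable \<omega>. integrable \<omega> (\<lambda>x. (cmod (f x))\<^sup>2)}"

text \<open>\<open>J\<close> sends a square-integrable function to the element of the ambient Hilbert space that its
  almost-everywhere class is regarded as. Since inner products are preserved, \<open>J f = J g\<close> holds
  exactly when \<open>f = g\<close> almost everywhere, so \<open>J ` square_integrable \<omega>\<close> is an isometric copy of
  \<open>L\<^sup>2(\<omega>)\<close>.\<close>

definition L2_inclusion ::
  "'a measure \<Rightarrow> (('a \<Rightarrow> complex) \<Rightarrow> 'x::complex_inner) \<Rightarrow> bool" where
  "L2_inclusion \<omega> J \<longleftrightarrow>
     (\<forall>f\<in>square_integrable \<omega>. \<forall>g\<in>square_integrable \<omega>. J (\<lambda>x. f x + g x) = J f + J g) \<and>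
     (\<forall>a. \<forall>f\<in>square_integrable \<omega>. J (\<lambda>x. a * f x) = a *\<^sub>C J f) \<and>
     (\<forall>f\<in>square_integrable \<omega>. \<forall>g\<in>square_integrable \<omega>.
        cinner (J f) (J g) = (LINT x|\<omega>. f x * cnj (g x)))"

definition koopman_operator ::
  "'a measure \<Rightarrow> (('a \<Rightarrow> complex) \<Rightarrow> 'x::complex_inner) \<Rightarrow> ('a \<Rightarrow> 'a) \<Rightarrow> ('x \<Rightarrow> 'x) \<Rightarrow> bool"
  where
  "koopman_operator \<omega> J F K \<longleftrightarrow>
     (\<forall>g\<in>square_integrable \<omega>.
        (\<lambda>x. g (F x)) \<in> square_integrable \<omega> \<and> K (J g) = J (\<lambda>x. g (F x)))"


section \<open>Measures on \<open>[-\<pi>,\<pi>]\<^sub>p\<^sub>e\<^sub>r\<close>\<close>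

text \<open>The interval with endpoints identified is represented by \<open>{-pi<..pi}\<close>, which contains one
  point of each class; its Borel sets are the Borel subsets of \<open>{-pi<..pi}\<close>. Continuous functions
  on it are the continuous functions on \<open>{-pi..pi}\<close> that agree at the two endpoints.\<close>

definition per_borel :: "real measure" where
  "per_borel = restrict_space borel {-pi<..pi}"

definition per_continuous :: "(real \<Rightarrow> complex) \<Rightarrow> bool" where
  "per_continuous \<phi> \<longleftrightarrow> continuous_on {-pi..pi} \<phi> \<and> \<phi> (-pi) = \<phi> pi"

definition per_weakly_converges :: "(nat \<Rightarrow> real measure) \<Rightarrow> real measure \<Rightarrow> bool" where
  "per_weakly_converges \<beta>s \<beta> \<longleftrightarrow>
     (\<forall>\<phi>. per_continuous \<phi> \<longrightarrow>
        (\<lambda>n. LINT \<theta>|\<beta>s n. \<phi> \<theta>) \<longlonglongrightarrow> (LINT \<theta>|\<beta>. \<phi> \<theta>))"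


section \<open>Projection-valued measures\<close>

definition projection_valued_measure ::
  "'x::complex_inner set \<Rightarrow> (real set \<Rightarrow> 'x \<Rightarrow> 'x) \<Rightarrow> bool" where
  "projection_valued_measure H E \<longleftrightarrow>
     (\<forall>S\<in>sets per_borel. clinear_operator_on H (E S) \<and>
        (\<forall>u\<in>H. E S (E S u) = E S u) \<and>
        (\<forall>u\<in>H. \<forall>v\<in>H. cinner (E S u) v = cinner u (E S v))) \<and>
     (\<forall>u\<in>H. E {} u = 0 \<and> E (space per_borel) u = u) \<and>
     (\<forall>S\<in>sets per_borel. \<forall>T\<in>sets per_borel. \<forall>u\<in>H. E (S \<inter> T) u = E S (E T u)) \<and>
     (\<forall>A. range A \<subseteq> sets per_borel \<longrightarrow> disjoint_family A \<longrightarrow>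
        (\<forall>u\<in>H. (\<lambda>n. E (A n) u) sums E (\<Union>n. A n) u))"

definition pvm_simple_integral ::
  "(real set \<Rightarrow> 'x \<Rightarrow> 'x) \<Rightarrow> (real \<Rightarrow> complex) \<Rightarrow> 'x \<Rightarrow> 'x::complex_inner" where
  "pvm_simple_integral E s u =
     (\<Sum>c\<in>s ` space per_borel. c *\<^sub>C E (s -` {c} \<inter> space per_borel) u)"

text \<open>The vector \<open>(\<integral>\<phi> dE) u\<close>, for bounded Borel \<open>\<phi>\<close>: the common limit of the integrals of all
  sequences of simple functions that converge to \<open>\<phi>\<close> uniformly.\<close>

definition pvm_integral ::
  "(real set \<Rightarrow> 'x \<Rightarrow> 'x) \<Rightarrow> (real \<Rightarrow> complex) \<Rightarrow> 'x \<Rightarrow> 'x::complex_inner" where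
  "pvm_integral E \<phi> u =
     (THE h. \<forall>s. (\<forall>n. simple_function per_borel (s n)) \<longrightarrow>
        uniform_limit (space per_borel) s \<phi> sequentially \<longrightarrow>
        (\<lambda>n. pvm_simple_integral E (s n) u) \<longlonglongrightarrow> h)"

text \<open>\<open>U = \<integral> exp(i\<theta>) dE(\<theta>)\<close>; by the spectral theorem every unitary \<open>U\<close> has exactly one such \<open>E\<close>
  (up to values off \<open>H\<close> and on sets that are not Borel).\<close>

definition spectral_pvm ::
  "'x::complex_inner set \<Rightarrow> ('x \<Rightarrow> 'x) \<Rightarrow> (real set \<Rightarrow> 'x \<Rightarrow> 'x) \<Rightarrow> bool" where
  "spectral_pvm H U E \<longleftrightarrow>
     projection_valued_measure H E \<and>
     (\<forall>u\<in>H. U u = pvm_integral E (\<lambda>\<theta>. exp (\<i> * complex_of_real \<theta>)) u)"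

definition scalar_spectral_measure ::
  "(real set \<Rightarrow> 'x \<Rightarrow> 'x) \<Rightarrow> 'x::complex_inner \<Rightarrow> real measure" where
  "scalar_spectral_measure E u =
     measure_of (space per_borel) (sets per_borel) (\<lambda>S. ennreal (Re (cinner (E S u) u)))"

definition functional_calculus_converges ::
  "'x::complex_inner set \<Rightarrow> (nat \<Rightarrow> 'x \<Rightarrow> 'x) \<Rightarrow>
     (nat \<Rightarrow> real set \<Rightarrow> 'x \<Rightarrow> 'x) \<Rightarrow> (real set \<Rightarrow> 'x \<Rightarrow> 'x) \<Rightarrow> bool" where
  "functional_calculus_converges H Pn En E \<longleftrightarrow>
     (\<forall>g\<in>H. \<forall>\<phi>. per_continuous \<phi> \<longrightarrow>
        (\<lambda>n. pvm_integral (En n) \<phi> (Pn n g)) \<longlonglongrightarrow> pvm_integral E \<phi> g)"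

end

theory Submission
  imports Defs
begin

text \<open>Write \<open>\<Phi>\<^sub>n \<phi>\<close> and \<open>\<Phi> \<phi>\<close> for the operators \<open>\<integral>\<phi> dE\<^sub>n\<close> and \<open>\<integral>\<phi> dE\<close>. Both are multiplicative
  and linear in \<open>\<phi>\<close> and bounded by the supremum of \<open>\<bar>\<phi>\<bar>\<close>. Call \<open>\<phi>\<close> good if \<open>\<Phi>\<^sub>n \<phi> (P\<^sub>n g)\<close> tends to \<open>\<Phi> \<phi> g\<close>
  for every \<open>g \<in> H\<close>.

  The bound, uniform in \<open>n\<close>, makes the good functions an algebra that is closed under uniform limits:
  \<open>\<Phi>\<^sub>n \<phi> (\<Phi>\<^sub>n \<psi> (P\<^sub>n g))\<close> may be replaced by \<open>\<Phi>\<^sub>n \<phi> (P\<^sub>n (\<Phi> \<psi> g))\<close> at a cost that tends to \<open>0\<close>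
  (\<open>calculus_converges_mult\<close>, \<open>calculus_converges_uniform_closure\<close>).

  The function \<open>exp (\<i> \<theta>)\<close> is good. Here unitarity enters: \<open>K\<^sub>n P\<^sub>n g\<close> converges weakly to \<open>K g\<close>, and its
  norm \<open>\<parallel>P\<^sub>n g\<parallel>\<close> converges to \<open>\<parallel>g\<parallel> = \<parallel>K g\<parallel>\<close>, so the convergence is strong (\<open>tendsto_of_weak_of_norm\<close>).
  A bounded reciprocal of a good function is good (\<open>calculus_converges_inverse\<close>), hence
  so is \<open>exp (- \<i> \<theta>)\<close>. The two exponentials generate all trigonometric polynomials, which are uniformly dense in the
  continuous periodic functions, so all of these are good: this is convergence in the functional calculus
  sense.

  Weak convergence of the scalar measures follows, because \<open>\<integral>\<phi> d\<xi>\<^sub>g\<close> is the inner product of \<open>\<Phi> \<phi> g\<close> with \<open>g\<close>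
  (\<open>integral_scalar_spectral_measure\<close>) and both arguments converge in norm.\<close>


section \<open>Complex inner products\<close>

lemma cinner_zero_left [simp]: "cinner 0 y = 0"
  using cinner_add_left[of 0 0 y] by simp

lemma cinner_diff_left: "cinner (x - y) z = cinner x z - cinner y z"
  using cinner_add_left[of "x - y" y z] by simp

lemma cinner_add_right: "cinner x (y + z) = cinner x y + cinner x z"
  by (metis cinner_add_left cinner_commute complex_cnj_add)

lemma cinner_scaleC_right: "cinner x (a *\<^sub>C y) = cnj a * cinner x y"
  by (metis cinner_commute cinner_scaleC_left complex_cnj_mult)

lemma cinner_self: "cinner x x = complex_of_real ((norm x)\<^sup>2)"
proof -
  have "Im (cinner x x) = 0"
    using arg_cong[OF cinner_commute[of x x], of Im] by simp
  moreover have "Re (cinner x x) = (norm x)\<^sup>2"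
    using norm_eq_sqrt_cinner[of x] norm_ge_zero[of x] by (simp add: real_sqrt_ge_0_iff)
  ultimately show ?thesis
    by (simp add: complex_eq_iff)
qed

lemma power2_norm_add: "(norm (x + y))\<^sup>2 = (norm x)\<^sup>2 + (norm y)\<^sup>2 + 2 * Re (cinner x y)"
proof -
  have "Re (cinner y x) = Re (cinner x y)"
    using arg_cong[OF cinner_commute[of y x], of Re] by simp
  moreover have "cinner (x + y) (x + y) = cinner x x + cinner y y + cinner x y + cinner y x"
    by (simp add: cinner_add_left cinner_add_right)
  ultimately show ?thesis
    by (simp only: cinner_self complex_eq_iff plus_complex.simps Re_complex_of_real)
qed

lemma norm_scaleC:
  fixes x :: "'x::complex_inner"
  shows "norm (a *\<^sub>C x) = cmod a * norm x"
proof -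
  have "complex_of_real ((norm (a *\<^sub>C x))\<^sup>2) = a * cnj a * cinner x x"
    by (simp only: cinner_self[symmetric, of "a *\<^sub>C x"] cinner_scaleC_left cinner_scaleC_right ac_simps)
  also have "\<dots> = complex_of_real ((cmod a)\<^sup>2) * complex_of_real ((norm x)\<^sup>2)"
    by (simp only: cinner_self complex_norm_square)
  also have "\<dots> = complex_of_real ((cmod a * norm x)\<^sup>2)"
    by (simp add: power_mult_distrib)
  finally have "complex_of_real ((norm (a *\<^sub>C x))\<^sup>2) = complex_of_real ((cmod a * norm x)\<^sup>2)" .
  then show ?thesis
    unfolding of_real_eq_iff by (simp add: power2_eq_iff_nonneg)
qed

text \<open>The triangle inequality of the norm bounds the real part of \<open>cinner x y\<close>; rotating \<open>x\<close> makes
  the inner product real and nonnegative.\<close>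

lemma Cauchy_Schwarz_cinner: "cmod (cinner x y) \<le> norm x * norm y"
proof (cases "cinner x y = 0")
  case False
  have Re_le: "Re (cinner v y) \<le> norm v * norm y" for v
  proof -
    have "(norm (v + y))\<^sup>2 \<le> (norm v + norm y)\<^sup>2"
      by (intro power_mono norm_triangle_ineq norm_ge_zero)
    then show ?thesis
      by (simp add: power2_norm_add power2_sum)
  qed
  define a where "a = cnj (cinner x y) / cmod (cinner x y)"
  have "cmod a = 1"
    using False by (simp add: a_def norm_divide)
  have "a * cinner x y = cmod (cinner x y)"
    using False by (simp add: a_def complex_norm_square[symmetric] mult.commute power2_eq_square)
  then have "cmod (cinner x y) = Re (cinner (a *\<^sub>C x) y)"
    by (simp add: cinner_scaleC_left)
  also have "\<dots> \<le> norm (a *\<^sub>C x) * norm y"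
    by (rule Re_le)
  finally show ?thesis
    using \<open>cmod a = 1\<close> by (simp add: norm_scaleC)
qed simp

lemma bounded_bilinear_cinner: "bounded_bilinear (cinner :: 'x::complex_inner \<Rightarrow> 'x \<Rightarrow> complex)"
proof
  show "\<exists>K. \<forall>a b :: 'x. cmod (cinner a b) \<le> norm a * norm b * K"
    by (rule exI[of _ 1]) (simp add: Cauchy_Schwarz_cinner)
qed (simp_all add: cinner_add_left cinner_add_right scaleR_scaleC cinner_scaleC_left
      cinner_scaleC_right scaleR_conv_of_real)

lemma bounded_bilinear_scaleC: "bounded_bilinear (scaleC :: complex \<Rightarrow> 'x::complex_inner \<Rightarrow> 'x)"
proof
  show "\<exists>K. \<forall>a. \<forall>b :: 'x. norm (a *\<^sub>C b) \<le> norm a * norm b * K"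
    by (rule exI[of _ 1]) (simp add: norm_scaleC)
qed (simp_all add: scaleC_add_left scaleC_add_right scaleR_scaleC scaleC_scaleC
      scaleR_conv_of_real mult.commute)

lemmas tendsto_cinner = bounded_bilinear.tendsto[OF bounded_bilinear_cinner]
lemmas tendsto_scaleC = bounded_bilinear.tendsto[OF bounded_bilinear_scaleC]
lemmas cinner_sum_left = bounded_bilinear.sum_left[OF bounded_bilinear_cinner]
lemmas cinner_sum_right = bounded_bilinear.sum_right[OF bounded_bilinear_cinner]

lemma power2_norm_sum_orthogonal:
  assumes "finite B" and "\<And>b c. b \<in> B \<Longrightarrow> c \<in> B \<Longrightarrow> b \<noteq> c \<Longrightarrow> cinner (x b) (x c) = 0"
  shows "(norm (\<Sum>b\<in>B. x b))\<^sup>2 = (\<Sum>b\<in>B. (norm (x b))\<^sup>2)"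
  using assms
proof (induction B rule: finite_induct)
  case (insert b B)
  have "cinner (x b) (\<Sum>c\<in>B. x c) = 0"
    using insert.hyps insert.prems by (auto simp: cinner_sum_right intro!: sum.neutral)
  then show ?case
    using insert by (simp add: power2_norm_add)
qed simp

lemma unitary_on_isometry:
  assumes "unitary_on H U" and "x \<in> H"
  shows "norm (U x) = norm x"
proof -
  obtain V where V: "\<forall>x\<in>H. \<forall>y\<in>H. cinner (U x) y = cinner x (V y)" "\<forall>x\<in>H. V (U x) = x"
    and "\<forall>x\<in>H. U x \<in> H"
    using assms(1) unfolding unitary_on_def clinear_operator_on_def by blast
  then have "cinner (U x) (U x) = cinner x x"
    using assms(2) by simp
  then show ?thesis
    unfolding cinner_self of_real_eq_iff by (simp add: power2_eq_iff_nonneg)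
qed

lemma orthogonal_projection_fixes:
  assumes "orthogonal_projection H P" and "csubspace H" and "g \<in> H"
  shows "P g = g"
proof -
  have "g - P g \<in> H"
    using assms complex_vector.subspace_diff unfolding orthogonal_projection_def by blast
  then have "cinner (g - P g) (g - P g) = 0"
    using assms(1) unfolding orthogonal_projection_def by blast
  then show ?thesis
    by (simp add: cinner_self)
qed

text \<open>Weak convergence together with convergence of the norms is strong convergence.\<close>

lemma tendsto_of_weak_of_norm:
  fixes x :: "nat \<Rightarrow> 'x::complex_inner"
  assumes "(\<lambda>n. cinner (x n) y) \<longlonglongrightarrow> cinner y y" and "(\<lambda>n. norm (x n)) \<longlonglongrightarrow> norm y"
  shows "x \<longlonglongrightarrow> y"
proof -
  have "(norm (x n - y))\<^sup>2 = (norm (x n))\<^sup>2 + (norm y)\<^sup>2 - 2 * Re (cinner (x n) y)" for n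
    using power2_norm_add[of "x n - y" y] by (simp add: cinner_diff_left cinner_self power2_eq_square)
  moreover have "(\<lambda>n. (norm (x n))\<^sup>2 + (norm y)\<^sup>2 - 2 * Re (cinner (x n) y))
      \<longlonglongrightarrow> (norm y)\<^sup>2 + (norm y)\<^sup>2 - 2 * Re (cinner y y)"
    by (intro tendsto_intros assms)
  ultimately have "(\<lambda>n. (norm (x n - y))\<^sup>2) \<longlonglongrightarrow> 0"
    by (simp add: cinner_self)
  then have "(\<lambda>n. sqrt ((norm (x n - y))\<^sup>2)) \<longlonglongrightarrow> sqrt 0"
    by (rule tendsto_real_sqrt)
  then show ?thesis
    by (simp add: tendsto_norm_zero_iff LIM_zero_iff)
qed


section \<open>Integration against a projection-valued measure\<close>

definition bounded_borel :: "(real \<Rightarrow> complex) \<Rightarrow> bool" where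
  "bounded_borel \<phi> \<longleftrightarrow> \<phi> \<in> borel_measurable per_borel \<and> bounded (\<phi> ` space per_borel)"

lemma space_per_borel: "space per_borel = {-pi<..pi}"
  by (simp add: per_borel_def space_restrict_space)

lemma space_per_borel_nonempty: "space per_borel \<noteq> {}"
  by (simp add: space_per_borel)

lemma cis_minus_pi: "cis (-pi) = -1"
  by (simp add: complex_eq_iff)

lemma bounded_borelE:
  assumes "bounded_borel \<phi>"
  obtains M where "M > 0" and "\<And>x. x \<in> space per_borel \<Longrightarrow> cmod (\<phi> x) \<le> M"
  using assms unfolding bounded_borel_def bounded_pos by auto

lemma bounded_borel_const: "bounded_borel (\<lambda>_. c)"
  by (simp add: bounded_borel_def image_constant_conv)

lemma bounded_borel_add:
  assumes "bounded_borel \<phi>" and "bounded_borel \<psi>"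
  shows "bounded_borel (\<lambda>x. \<phi> x + \<psi> x)"
  using assms unfolding bounded_borel_def by (auto intro: bounded_plus_comp)

lemma bounded_borel_mult:
  assumes "bounded_borel \<phi>" and "bounded_borel \<psi>"
  shows "bounded_borel (\<lambda>x. \<phi> x * \<psi> x)"
proof -
  obtain M N where "\<And>x. x \<in> space per_borel \<Longrightarrow> cmod (\<phi> x) \<le> M"
    and "\<And>x. x \<in> space per_borel \<Longrightarrow> cmod (\<psi> x) \<le> N" and "M > 0"
    using bounded_borelE[OF assms(1)] bounded_borelE[OF assms(2)] by metis
  then have "\<forall>x \<in> space per_borel. cmod (\<phi> x * \<psi> x) \<le> M * N"
    by (auto simp: norm_mult intro!: mult_mono)
  then show ?thesis
    using assms unfolding bounded_borel_def by (auto simp: bounded_iff)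
qed

lemma bounded_borel_diff:
  assumes "bounded_borel \<phi>" and "bounded_borel \<psi>"
  shows "bounded_borel (\<lambda>x. \<phi> x - \<psi> x)"
  using bounded_borel_add[OF assms(1) bounded_borel_mult[OF bounded_borel_const[of "-1"] assms(2)]]
  by simp

lemma bounded_borel_per_continuous:
  assumes "per_continuous \<phi>"
  shows "bounded_borel \<phi>"
proof -
  have cont: "continuous_on {-pi..pi} \<phi>"
    using assms by (simp add: per_continuous_def)
  then have "continuous_on {-pi<..pi} \<phi>"
    by (rule continuous_on_subset) auto
  then have "\<phi> \<in> borel_measurable per_borel"
    unfolding per_borel_def by (rule borel_measurable_continuous_on_restrict)
  moreover have "bounded (\<phi> ` {-pi..pi})"
    using cont by (intro compact_imp_bounded compact_continuous_image) auto
  then have "bounded (\<phi> ` space per_borel)"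
    by (rule bounded_subset) (auto simp: space_per_borel)
  ultimately show ?thesis
    by (simp add: bounded_borel_def)
qed

text \<open>Rounding real and imaginary part down to multiples of \<open>1 / Suc n\<close> leaves finitely many values
  because the function is bounded.\<close>

lemma bounded_borel_simple_approximation:
  assumes "bounded_borel \<phi>"
  obtains s where "\<And>n. simple_function per_borel (s n)"
    and "\<And>n x. cmod (s n x - \<phi> x) \<le> 2 / Suc n"
proof
  define r where "r n a = real_of_int \<lfloor>Suc n * a\<rfloor> / Suc n" for n and a :: real
  define s where "s n x = complex_of_real (r n (Re (\<phi> x))) + \<i> * complex_of_real (r n (Im (\<phi> x)))"
    for n x
  have r_bound: "\<bar>r n a - a\<bar> \<le> 1 / Suc n" for n a
  proof -
    have "r n a - a = (real_of_int \<lfloor>Suc n * a\<rfloor> - Suc n * a) / Suc n"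
      by (simp add: r_def diff_divide_distrib)
    moreover have "\<bar>real_of_int \<lfloor>Suc n * a\<rfloor> - Suc n * a\<bar> \<le> 1"
      by linarith
    ultimately show ?thesis
      by (simp add: abs_divide divide_right_mono del: of_nat_Suc)
  qed
  show "cmod (s n x - \<phi> x) \<le> 2 / Suc n" for n x
  proof -
    have "cmod (s n x - \<phi> x) \<le> \<bar>r n (Re (\<phi> x)) - Re (\<phi> x)\<bar> + \<bar>r n (Im (\<phi> x)) - Im (\<phi> x)\<bar>"
      using cmod_le[of "s n x - \<phi> x"] by (simp add: s_def)
    also have "\<dots> \<le> 1 / Suc n + 1 / Suc n"
      by (intro add_mono r_bound)
    finally show ?thesis
      by simp
  qed
  show "simple_function per_borel (s n)" for n
  proof (rule simple_function_borel_measurable)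
    have [measurable]: "\<phi> \<in> borel_measurable per_borel"
      using assms by (simp add: bounded_borel_def)
    show "s n \<in> borel_measurable per_borel"
      unfolding s_def r_def by measurable
    obtain M where M: "\<And>x. x \<in> space per_borel \<Longrightarrow> cmod (\<phi> x) \<le> M"
      using bounded_borelE[OF assms] by blast
    define L where "L = \<lceil>Suc n * M\<rceil> + 1"
    have floor_in: "\<lfloor>Suc n * a\<rfloor> \<in> {-L..L}" if "\<bar>a\<bar> \<le> M" for a :: real
    proof -
      have "\<bar>Suc n * a\<bar> \<le> Suc n * M"
        using that by (simp add: abs_mult mult_left_mono del: of_nat_Suc)
      then show ?thesis
        unfolding L_def atLeastAtMost_iff by linarith
    qed
    have "s n ` space per_borel \<subseteq>
        (\<lambda>(a, b). complex_of_real (real_of_int a / Suc n) + \<i> * complex_of_real (real_of_int b / Suc n))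
          ` ({-L..L} \<times> {-L..L})"
    proof safe
      fix x assume "x \<in> space per_borel"
      then have "\<bar>Re (\<phi> x)\<bar> \<le> M" "\<bar>Im (\<phi> x)\<bar> \<le> M"
        using M abs_Re_le_cmod abs_Im_le_cmod order_trans by blast+
      then show "s n x \<in> (\<lambda>(a, b). complex_of_real (real_of_int a / Suc n) +
          \<i> * complex_of_real (real_of_int b / Suc n)) ` ({-L..L} \<times> {-L..L})"
        using floor_in unfolding s_def r_def
        by (intro rev_image_eqI[of "(\<lfloor>Suc n * Re (\<phi> x)\<rfloor>, \<lfloor>Suc n * Im (\<phi> x)\<rfloor>)"]) auto
    qed
    then show "finite (s n ` space per_borel)"
      by (rule finite_subset) simp
  qed
qed

lemma uniform_limit_simple_approximation:
  assumes "\<And>n x. cmod (s n x - \<phi> x) \<le> 2 / Suc n"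
  shows "uniform_limit A s \<phi> sequentially"
proof (rule uniform_limitI)
  fix e :: real assume "e > 0"
  have "(\<lambda>n. 2 * inverse (real (Suc n))) \<longlonglongrightarrow> 2 * 0"
    by (intro tendsto_intros LIMSEQ_inverse_real_of_nat)
  then have "\<forall>\<^sub>F n in sequentially. 2 / real (Suc n) < e"
    using \<open>e > 0\<close> unfolding divide_inverse mult_zero_right by (rule order_tendstoD(2))
  then show "\<forall>\<^sub>F n in sequentially. \<forall>x\<in>A. dist (s n x) (\<phi> x) < e"
    using assms by (auto simp: dist_norm elim!: eventually_mono intro: le_less_trans)
qed

locale pvm =
  fixes H :: "'x::complex_hilbert_space set" and E :: "real set \<Rightarrow> 'x \<Rightarrow> 'x"
  assumes closed_csubspace: "closed_csubspace H"
    and projection_valued: "projection_valued_measure H E"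
begin

lemma csubspace: "csubspace H"
  using closed_csubspace by (simp add: closed_csubspace_def)

lemma closed: "closed H"
  using closed_csubspace by (simp add: closed_csubspace_def)

lemmas diff_mem = complex_vector.subspace_diff[OF csubspace]
  and scaleC_mem = complex_vector.subspace_scale[OF csubspace]
  and sum_mem = complex_vector.subspace_sum[OF csubspace]

lemma
  assumes "S \<in> sets per_borel"
  shows E_mem: "u \<in> H \<Longrightarrow> E S u \<in> H"
    and E_add: "u \<in> H \<Longrightarrow> v \<in> H \<Longrightarrow> E S (u + v) = E S u + E S v"
    and E_scaleC: "u \<in> H \<Longrightarrow> E S (a *\<^sub>C u) = a *\<^sub>C E S u"
    and E_idem: "u \<in> H \<Longrightarrow> E S (E S u) = E S u"
    and E_self_adjoint: "u \<in> H \<Longrightarrow> v \<in> H \<Longrightarrow> cinner (E S u) v = cinner u (E S v)"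
  using bspec[OF conjunct1[OF projection_valued[unfolded projection_valued_measure_def]] assms]
  by (simp_all add: clinear_operator_on_def)

lemma
  assumes "u \<in> H"
  shows E_empty: "E {} u = 0"
    and E_space: "E (space per_borel) u = u"
    and E_Int: "S \<in> sets per_borel \<Longrightarrow> T \<in> sets per_borel \<Longrightarrow> E (S \<inter> T) u = E S (E T u)"
    and E_sums: "range A \<subseteq> sets per_borel \<Longrightarrow> disjoint_family A \<Longrightarrow>
      (\<lambda>n. E (A n) u) sums E (\<Union>n. A n) u"
  using conjunct2[OF projection_valued[unfolded projection_valued_measure_def]] assms
  by simp_all

lemma E_sum:
  assumes "S \<in> sets per_borel" and "finite T" and "\<And>d. x d \<in> H"
  shows "E S (\<Sum>d\<in>T. x d) = (\<Sum>d\<in>T. E S (x d))"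
  using assms(2)
proof (induction T rule: finite_induct)
  case empty
  show ?case
    using E_scaleC[OF assms(1,3), of 0] by simp
qed (use assms in \<open>simp add: E_add sum_mem\<close>)

lemma E_Un:
  assumes "S \<in> sets per_borel" "T \<in> sets per_borel" "S \<inter> T = {}" "u \<in> H"
  shows "E (S \<union> T) u = E S u + E T u"
proof -
  have "(\<lambda>n. E (binaryset S T n) u) sums E (\<Union>n. binaryset S T n) u"
    using assms
    by (intro E_sums) (auto simp: range_binaryset_eq disjoint_family_on_def binaryset_def)
  moreover have "(\<lambda>n. E (binaryset S T n) u) sums (E S u + E T u)"
    using E_empty[OF assms(4)] by (rule binaryset_sums)
  ultimately show ?thesis
    unfolding UN_binaryset_eq by (rule sums_unique2)
qed

lemma E_UN:
  assumes "finite B" and "\<And>b. b \<in> B \<Longrightarrow> A b \<in> sets per_borel" and "disjoint_family_on A B" and "u \<in> H"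
  shows "E (\<Union>b\<in>B. A b) u = (\<Sum>b\<in>B. E (A b) u)"
  using assms
proof (induction B rule: finite_induct)
  case empty
  then show ?case
    by (simp add: E_empty)
next
  case (insert b B)
  have "E (A b \<union> (\<Union>c\<in>B. A c)) u = E (A b) u + E (\<Union>c\<in>B. A c) u"
    using insert by (intro E_Un sets.finite_UN) (auto simp: disjoint_family_on_insert)
  then show ?case
    using insert by (auto simp: disjoint_family_on_insert)
qed

lemma cinner_E_self:
  assumes "S \<in> sets per_borel" "u \<in> H"
  shows "cinner (E S u) u = complex_of_real ((norm (E S u))\<^sup>2)"
  using E_self_adjoint[OF assms(1) E_mem[OF assms] assms(2)] E_idem[OF assms]
  by (simp add: cinner_self)

lemma E_orthogonal:
  assumes "S \<in> sets per_borel" "T \<in> sets per_borel" "S \<inter> T = {}" "u \<in> H" "v \<in> H"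
  shows "cinner (E S u) (E T v) = 0"
proof -
  have "cinner (E S u) (E T v) = cinner (E T (E S u)) v"
    by (rule E_self_adjoint[OF assms(2) E_mem[OF assms(1,4)] assms(5), symmetric])
  also have "E T (E S u) = E {} u"
    using E_Int[OF assms(4,2,1)] assms(3) by (simp only: Int_commute)
  finally show ?thesis
    by (simp only: E_empty[OF assms(4)] cinner_zero_left)
qed

subsection \<open>Simple functions\<close>

text \<open>Refining the level sets of a simple function does not change its integral. Taking for \<open>r\<close> a
  pair of simple functions brings two of them to a common partition, from which the algebraic rules
  follow. Values in \<open>B\<close> that \<open>r\<close> does not take contribute \<open>E {} u = 0\<close>.\<close>

lemma simple_integral_refine:
  assumes "simple_function per_borel r" and "finite B" and "r ` space per_borel \<subseteq> B" and "u \<in> H"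
  shows "pvm_simple_integral E (\<lambda>x. f (r x)) u =
    (\<Sum>b\<in>B. f b *\<^sub>C E (r -` {b} \<inter> space per_borel) u)"
proof -
  let ?R = "r ` space per_borel" and ?A = "\<lambda>b. r -` {b} \<inter> space per_borel"
  have fin: "finite ?R"
    by (rule finite_subset[OF assms(3,2)])
  have meas: "?A b \<in> sets per_borel" for b
    using simple_functionD(2)[OF assms(1)] by blast
  have "(\<Sum>b\<in>B. f b *\<^sub>C E (?A b) u) = (\<Sum>b\<in>?R. f b *\<^sub>C E (?A b) u)"
  proof (rule sum.mono_neutral_right[OF assms(2,3)], rule ballI)
    fix b assume "b \<in> B - ?R"
    then have "?A b = {}"
      by auto
    then show "f b *\<^sub>C E (?A b) u = 0"
      using assms(4) by (simp add: E_empty)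
  qed
  also have "\<dots> = (\<Sum>c\<in>f ` ?R. \<Sum>b\<in>{b \<in> ?R. f b = c}. f b *\<^sub>C E (?A b) u)"
    using fin by (rule sum.image_gen)
  also have "\<dots> = (\<Sum>c\<in>f ` ?R. c *\<^sub>C E ((\<lambda>x. f (r x)) -` {c} \<inter> space per_borel) u)"
  proof (rule sum.cong[OF refl])
    fix c
    have "(\<lambda>x. f (r x)) -` {c} \<inter> space per_borel = (\<Union>b\<in>{b \<in> ?R. f b = c}. ?A b)"
      by auto
    also have "E \<dots> u = (\<Sum>b\<in>{b \<in> ?R. f b = c}. E (?A b) u)"
      proof (rule E_UN)
      show "disjoint_family_on ?A {b \<in> ?R. f b = c}"
        by (auto simp only: disjoint_family_on_def)
    qed (use fin meas assms(4) in simp_all)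
    finally show "(\<Sum>b\<in>{b \<in> ?R. f b = c}. f b *\<^sub>C E (?A b) u) =
        c *\<^sub>C E ((\<lambda>x. f (r x)) -` {c} \<inter> space per_borel) u"
      by (simp add: complex_vector.scale_sum_right)
  qed
  finally show ?thesis
    by (simp add: pvm_simple_integral_def image_image)
qed

lemma simple_integral_mem:
  assumes "simple_function per_borel s" and "u \<in> H"
  shows "pvm_simple_integral E s u \<in> H"
  unfolding pvm_simple_integral_def
  using assms by (intro sum_mem scaleC_mem E_mem simple_functionD(2))

lemma simple_integral_diff_vector:
  assumes "simple_function per_borel s" and "u \<in> H" and "v \<in> H"
  shows "pvm_simple_integral E s (u - v) = pvm_simple_integral E s u - pvm_simple_integral E s v"
proof -
  have "E S (u - v) = E S u - E S v" if "S \<in> sets per_borel" for S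
    using E_add[OF that diff_mem[OF assms(2,3)] assms(3)] by simp
  then show ?thesis
    unfolding pvm_simple_integral_def sum_subtractf[symmetric]
    using assms by (intro sum.cong refl)
      (simp add: simple_functionD(2) complex_vector.scale_right_diff_distrib)
qed

lemma simple_integral_const:
  assumes "u \<in> H"
  shows "pvm_simple_integral E (\<lambda>_. c) u = c *\<^sub>C u"
  using simple_integral_refine[of "\<lambda>_. 0 :: nat" "{0}" u "\<lambda>_. c"] assms
  by (simp add: E_space image_subset_iff)

lemma
  assumes "simple_function per_borel s" and "simple_function per_borel t" and "u \<in> H"
  shows simple_integral_add: "pvm_simple_integral E (\<lambda>x. s x + t x) u =
      pvm_simple_integral E s u + pvm_simple_integral E t u"
    and simple_integral_mult: "pvm_simple_integral E (\<lambda>x. s x * t x) u =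
      pvm_simple_integral E s (pvm_simple_integral E t u)"
proof -
  let ?S = "s ` space per_borel" and ?T = "t ` space per_borel"
  let ?A = "\<lambda>c. s -` {c} \<inter> space per_borel" and ?B = "\<lambda>d. t -` {d} \<inter> space per_borel"
  have fin: "finite (?S \<times> ?T)"
    using assms simple_functionD(1) by blast
  have meas: "?A c \<in> sets per_borel" "?B c \<in> sets per_borel" for c
    using assms simple_functionD(2) by blast+
  note refine = simple_integral_refine[OF simple_function_Pair[OF assms(1,2)] fin _ assms(3)]
  have pair: "pvm_simple_integral E (\<lambda>x. f (s x, t x)) u =
      (\<Sum>b\<in>?S \<times> ?T. f b *\<^sub>C E ((\<lambda>x. (s x, t x)) -` {b} \<inter> space per_borel) u)" for f
    by (rule refine) auto
  show "pvm_simple_integral E (\<lambda>x. s x + t x) u =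
      pvm_simple_integral E s u + pvm_simple_integral E t u"
    using pair[of "\<lambda>b. fst b + snd b"] pair[of fst] pair[of snd]
    by (simp add: scaleC_add_left sum.distrib)
  have "pvm_simple_integral E s (pvm_simple_integral E t u) =
      (\<Sum>c\<in>?S. \<Sum>d\<in>?T. (c * d) *\<^sub>C E (?A c \<inter> ?B d) u)"
    unfolding pvm_simple_integral_def[of E s]
  proof (rule sum.cong[OF refl])
    fix c
    have "E (?A c) (pvm_simple_integral E t u) = (\<Sum>d\<in>?T. E (?A c) (d *\<^sub>C E (?B d) u))"
      unfolding pvm_simple_integral_def
      by (rule E_sum[OF meas(1) simple_functionD(1)[OF assms(2)] scaleC_mem[OF E_mem[OF meas(2) assms(3)]]])
    also have "\<dots> = (\<Sum>d\<in>?T. d *\<^sub>C E (?A c \<inter> ?B d) u)"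
      by (simp only: E_scaleC[OF meas(1) E_mem[OF meas(2) assms(3)]] E_Int[OF assms(3) meas])
    finally show "c *\<^sub>C E (?A c) (pvm_simple_integral E t u) =
        (\<Sum>d\<in>?T. (c * d) *\<^sub>C E (?A c \<inter> ?B d) u)"
      by (simp only: complex_vector.scale_sum_right scaleC_scaleC)
  qed
  also have "\<dots> = (\<Sum>(c, d)\<in>?S \<times> ?T. (c * d) *\<^sub>C E (?A c \<inter> ?B d) u)"
    by (rule sum.cartesian_product)
  also have "\<dots> = pvm_simple_integral E (\<lambda>x. s x * t x) u"
  proof -
    have "(\<lambda>x. (s x, t x)) -` {b} \<inter> space per_borel = ?A (fst b) \<inter> ?B (snd b)" for b
      by auto
    then show ?thesis
      using pair[of "\<lambda>b. fst b * snd b"] by (simp only: case_prod_unfold fst_conv snd_conv)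
  qed
  finally show "pvm_simple_integral E (\<lambda>x. s x * t x) u =
      pvm_simple_integral E s (pvm_simple_integral E t u)" ..
qed

text \<open>The vectors \<open>E (s -` {c}) u\<close> are orthogonal with sum \<open>u\<close>, so by Pythagoras scaling each of them
  by at most \<open>M\<close> scales the norm of the sum by at most \<open>M\<close>.\<close>

lemma norm_simple_integral_le:
  assumes s: "simple_function per_borel s" and "u \<in> H"
    and M: "\<And>x. x \<in> space per_borel \<Longrightarrow> cmod (s x) \<le> M"
  shows "norm (pvm_simple_integral E s u) \<le> M * norm u"
proof -
  let ?S = "s ` space per_borel" and ?A = "\<lambda>c. s -` {c} \<inter> space per_borel"
  have "M \<ge> 0"
    using M space_per_borel_nonempty norm_ge_zero order_trans by blast
  have fin: "finite ?S"
    using s by (rule simple_functionD(1))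
  have orth: "cinner (E (?A c) u) (E (?A d) u) = 0" if "c \<noteq> d" for c d
    using that assms(2) s by (intro E_orthogonal simple_functionD(2)) auto
  have total: "(\<Sum>c\<in>?S. E (?A c) u) = u"
    using simple_integral_refine[OF s fin _ assms(2), of "\<lambda>_. 1"] simple_integral_const[OF assms(2), of 1]
    by (simp add: scaleC_one)
  have "(norm (pvm_simple_integral E s u))\<^sup>2 = (\<Sum>c\<in>?S. (cmod c * norm (E (?A c) u))\<^sup>2)"
    unfolding pvm_simple_integral_def norm_scaleC[symmetric]
    using fin by (rule power2_norm_sum_orthogonal)
      (simp add: cinner_scaleC_left cinner_scaleC_right orth)
  also have "\<dots> \<le> (\<Sum>c\<in>?S. (M * norm (E (?A c) u))\<^sup>2)"
    using M by (intro sum_mono power_mono mult_right_mono) auto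
  also have "\<dots> = M\<^sup>2 * (norm (\<Sum>c\<in>?S. E (?A c) u))\<^sup>2"
    using power2_norm_sum_orthogonal[OF fin, of "\<lambda>c. E (?A c) u"] orth
    by (simp add: power_mult_distrib sum_distrib_left)
  finally have "(norm (pvm_simple_integral E s u))\<^sup>2 \<le> (M * norm u)\<^sup>2"
    by (simp add: total power_mult_distrib)
  then show ?thesis
    by (rule power2_le_imp_le) (simp add: \<open>M \<ge> 0\<close>)
qed

lemma norm_simple_integral_diff_le:
  assumes s: "simple_function per_borel s" and t: "simple_function per_borel t" and "u \<in> H"
    and "\<And>x. x \<in> space per_borel \<Longrightarrow> dist (s x) (t x) \<le> e"
  shows "dist (pvm_simple_integral E s u) (pvm_simple_integral E t u) \<le> e * norm u"
proof -
  have d: "simple_function per_borel (\<lambda>x. s x - t x)"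
    using s t by (rule simple_function_diff)
  have "pvm_simple_integral E s u =
      pvm_simple_integral E t u + pvm_simple_integral E (\<lambda>x. s x - t x) u"
    using simple_integral_add[OF t d assms(3)] by simp
  then show ?thesis
    using norm_simple_integral_le[OF d assms(3)] assms(4) by (simp add: dist_norm)
qed

subsection \<open>Bounded Borel functions\<close>

text \<open>This discharges the definite description in \<open>pvm_integral\<close>. Integrals of uniformly close simple
  functions are close, so the integrals along any one approximating sequence form a Cauchy sequence, and those along
  any two such sequences have the same limit.\<close>

lemma pvm_integral_tendsto:
  assumes s: "\<And>n. simple_function per_borel (s n)"
    and lim: "uniform_limit (space per_borel) s \<phi> sequentially" and u: "u \<in> H"
  shows "(\<lambda>n. pvm_simple_integral E (s n) u) \<longlonglongrightarrow> pvm_integral E \<phi> u"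
proof -
  have close: "\<exists>N. \<forall>m\<ge>N. \<forall>n\<ge>N.
      dist (pvm_simple_integral E (s m) u) (pvm_simple_integral E (t n) u) < e"
    if t: "\<And>n. simple_function per_borel (t n)"
      and lim_t: "uniform_limit (space per_borel) t \<phi> sequentially" and "e > 0" for t e
  proof -
    \<comment> \<open>The summand \<open>1\<close> covers \<open>u = 0\<close>.\<close>
    define d where "d = e / (2 * (norm u + 1))"
    have "d > 0"
      using \<open>e > 0\<close> by (simp add: d_def add_nonneg_pos)
    then have "\<forall>\<^sub>F n in sequentially. \<forall>x\<in>space per_borel. dist (s n x) (\<phi> x) < d"
      "\<forall>\<^sub>F n in sequentially. \<forall>x\<in>space per_borel. dist (t n x) (\<phi> x) < d"
      using uniform_limitD lim lim_t by blast+
    then obtain N where N: "\<And>n x. n \<ge> N \<Longrightarrow> x \<in> space per_borel \<Longrightarrow> dist (s n x) (\<phi> x) < d"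
      "\<And>n x. n \<ge> N \<Longrightarrow> x \<in> space per_borel \<Longrightarrow> dist (t n x) (\<phi> x) < d"
      using eventually_conj unfolding eventually_sequentially by (metis le_trans nat_le_linear)
    have "dist (pvm_simple_integral E (s m) u) (pvm_simple_integral E (t n) u) < e"
      if "m \<ge> N" "n \<ge> N" for m n
    proof -
      have "dist (s m x) (t n x) \<le> 2 * d" if "x \<in> space per_borel" for x
        using N(1)[OF \<open>m \<ge> N\<close> that] N(2)[OF \<open>n \<ge> N\<close> that] dist_triangle2[of "s m x" "t n x" "\<phi> x"]
        by linarith
      then have "dist (pvm_simple_integral E (s m) u) (pvm_simple_integral E (t n) u) \<le> 2 * d * norm u"
        by (rule norm_simple_integral_diff_le[OF s t u])
      also have "\<dots> < 2 * d * (norm u + 1)"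
        using \<open>d > 0\<close> by simp
      also have "\<dots> = e"
        using add_nonneg_pos[OF norm_ge_zero[of u] zero_less_one] by (simp add: d_def field_simps)
      finally show ?thesis .
    qed
    then show ?thesis
      by blast
  qed
  have "Cauchy (\<lambda>n. pvm_simple_integral E (s n) u)"
    unfolding Cauchy_def using close[OF s lim] by blast
  then obtain h where h: "(\<lambda>n. pvm_simple_integral E (s n) u) \<longlonglongrightarrow> h"
    using Cauchy_convergent convergent_def by blast
  have same: "(\<lambda>n. pvm_simple_integral E (t n) u) \<longlonglongrightarrow> h"
    if "\<forall>n. simple_function per_borel (t n)" "uniform_limit (space per_borel) t \<phi> sequentially" for t
  proof -
    have "(\<lambda>n. dist (pvm_simple_integral E (s n) u) (pvm_simple_integral E (t n) u)) \<longlonglongrightarrow> 0"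
      unfolding LIMSEQ_iff using close[of t] that by (simp, meson)
    then have "(\<lambda>n. pvm_simple_integral E (s n) u - pvm_simple_integral E (t n) u) \<longlonglongrightarrow> 0"
      unfolding dist_norm by (rule tendsto_norm_zero_cancel)
    with h show ?thesis
      by (rule Lim_transform2)
  qed
  have "pvm_integral E \<phi> u = h"
    unfolding pvm_integral_def
  proof (rule the_equality)
    show "\<forall>s. (\<forall>n. simple_function per_borel (s n)) \<longrightarrow>
        uniform_limit (space per_borel) s \<phi> sequentially \<longrightarrow>
        (\<lambda>n. pvm_simple_integral E (s n) u) \<longlonglongrightarrow> h"
      using same by blast
  next
    fix h' assume "\<forall>s. (\<forall>n. simple_function per_borel (s n)) \<longrightarrow>
        uniform_limit (space per_borel) s \<phi> sequentially \<longrightarrow>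
        (\<lambda>n. pvm_simple_integral E (s n) u) \<longlonglongrightarrow> h'"
    then have "(\<lambda>n. pvm_simple_integral E (s n) u) \<longlonglongrightarrow> h'"
      using s lim by blast
    then show "h' = h"
      using h by (rule LIMSEQ_unique)
  qed
  then show ?thesis
    using h by simp
qed

lemma pvm_integral_mem:
  assumes "bounded_borel \<phi>" and "u \<in> H"
  shows "pvm_integral E \<phi> u \<in> H"
proof -
  obtain s where s: "\<And>n. simple_function per_borel (s n)"
    "\<And>n x. cmod (s n x - \<phi> x) \<le> 2 / Suc n"
    using bounded_borel_simple_approximation[OF assms(1)] by blast
  show ?thesis
  proof (rule closed_sequentially[OF closed])
    show "pvm_simple_integral E (s n) u \<in> H" for n
      using s(1) assms(2) by (rule simple_integral_mem)
    show "(\<lambda>n. pvm_simple_integral E (s n) u) \<longlonglongrightarrow> pvm_integral E \<phi> u"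
      by (rule pvm_integral_tendsto[OF s(1) uniform_limit_simple_approximation[OF s(2)] assms(2)])
  qed
qed

lemma pvm_integral_const:
  assumes "u \<in> H"
  shows "pvm_integral E (\<lambda>_. c) u = c *\<^sub>C u"
proof -
  have "(\<lambda>n. pvm_simple_integral E (\<lambda>_. c) u) \<longlonglongrightarrow> pvm_integral E (\<lambda>_. c) u"
    by (rule pvm_integral_tendsto[OF _ _ assms]) (auto intro: uniform_limit_const)
  then show ?thesis
    by (simp add: simple_integral_const[OF assms] LIMSEQ_const_iff)
qed

lemma pvm_integral_diff_vector:
  assumes "bounded_borel \<phi>" and "u \<in> H" and "v \<in> H"
  shows "pvm_integral E \<phi> (u - v) = pvm_integral E \<phi> u - pvm_integral E \<phi> v"
proof -
  obtain s where s: "\<And>n. simple_function per_borel (s n)"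
    "\<And>n x. cmod (s n x - \<phi> x) \<le> 2 / Suc n"
    using bounded_borel_simple_approximation[OF assms(1)] by blast
  note lim = pvm_integral_tendsto[OF s(1) uniform_limit_simple_approximation[OF s(2)]]
  have "(\<lambda>n. pvm_simple_integral E (s n) u - pvm_simple_integral E (s n) v)
      \<longlonglongrightarrow> pvm_integral E \<phi> u - pvm_integral E \<phi> v"
    by (intro tendsto_diff lim assms)
  then show ?thesis
    using lim[OF diff_mem[OF assms(2,3)]] assms(2,3)
    by (simp add: simple_integral_diff_vector[OF s(1)] LIMSEQ_unique)
qed

lemma pvm_integral_add:
  assumes "bounded_borel \<phi>" and "bounded_borel \<psi>" and "u \<in> H"
  shows "pvm_integral E (\<lambda>x. \<phi> x + \<psi> x) u = pvm_integral E \<phi> u + pvm_integral E \<psi> u"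
proof -
  obtain s where s: "\<And>n. simple_function per_borel (s n)"
    "\<And>n x. cmod (s n x - \<phi> x) \<le> 2 / Suc n"
    using bounded_borel_simple_approximation[OF assms(1)] by blast
  obtain t where t: "\<And>n. simple_function per_borel (t n)"
    "\<And>n x. cmod (t n x - \<psi> x) \<le> 2 / Suc n"
    using bounded_borel_simple_approximation[OF assms(2)] by blast
  note lim_s = uniform_limit_simple_approximation[OF s(2)]
    and lim_t = uniform_limit_simple_approximation[OF t(2)]
  have "(\<lambda>n. pvm_simple_integral E (\<lambda>x. s n x + t n x) u)
      \<longlonglongrightarrow> pvm_integral E (\<lambda>x. \<phi> x + \<psi> x) u"
    by (intro pvm_integral_tendsto simple_function_add s t uniform_limit_add lim_s lim_t assms)
  moreover have "(\<lambda>n. pvm_simple_integral E (s n) u + pvm_simple_integral E (t n) u)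
      \<longlonglongrightarrow> pvm_integral E \<phi> u + pvm_integral E \<psi> u"
    by (intro tendsto_add pvm_integral_tendsto s t lim_s lim_t assms)
  ultimately show ?thesis
    using assms(3) by (simp add: simple_integral_add[OF s(1) t(1)] LIMSEQ_unique)
qed

lemma norm_pvm_integral_le:
  assumes "bounded_borel \<phi>" and "u \<in> H"
    and M: "\<And>x. x \<in> space per_borel \<Longrightarrow> cmod (\<phi> x) \<le> M"
  shows "norm (pvm_integral E \<phi> u) \<le> M * norm u"
proof -
  obtain s where s: "\<And>n. simple_function per_borel (s n)"
    "\<And>n x. cmod (s n x - \<phi> x) \<le> 2 / Suc n"
    using bounded_borel_simple_approximation[OF assms(1)] by blast
  have "norm (pvm_simple_integral E (s n) u) \<le> (M + 2 * inverse (real (Suc n))) * norm u" for n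
  proof (rule norm_simple_integral_le[OF s(1) assms(2)])
    fix x assume "x \<in> space per_borel"
    then show "cmod (s n x) \<le> M + 2 * inverse (real (Suc n))"
      using s(2)[of n x] M[of x] norm_triangle_sub[of "s n x" "\<phi> x"] by (simp add: divide_inverse)
  qed
  moreover have "(\<lambda>n. (M + 2 * inverse (real (Suc n))) * norm u) \<longlonglongrightarrow> (M + 2 * 0) * norm u"
    by (intro tendsto_intros LIMSEQ_inverse_real_of_nat)
  moreover have "(\<lambda>n. norm (pvm_simple_integral E (s n) u)) \<longlonglongrightarrow> norm (pvm_integral E \<phi> u)"
    by (intro tendsto_norm pvm_integral_tendsto s(1) uniform_limit_simple_approximation s(2) assms)
  ultimately show ?thesis
    using LIMSEQ_le by fastforce
qed

text \<open>The simple functions \<open>s\<^sub>n\<close> approximating \<open>\<phi>\<close> are uniformly bounded, so their integrals may be applied to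
  the converging vectors \<open>(\<integral>t\<^sub>n dE) u\<close> in the limit.\<close>

lemma pvm_integral_mult:
  assumes "bounded_borel \<phi>" and "bounded_borel \<psi>" and u: "u \<in> H"
  shows "pvm_integral E (\<lambda>x. \<phi> x * \<psi> x) u = pvm_integral E \<phi> (pvm_integral E \<psi> u)"
proof -
  obtain s where s: "\<And>n. simple_function per_borel (s n)"
    "\<And>n x. cmod (s n x - \<phi> x) \<le> 2 / Suc n"
    using bounded_borel_simple_approximation[OF assms(1)] by blast
  obtain t where t: "\<And>n. simple_function per_borel (t n)"
    "\<And>n x. cmod (t n x - \<psi> x) \<le> 2 / Suc n"
    using bounded_borel_simple_approximation[OF assms(2)] by blast
  note lim_s = uniform_limit_simple_approximation[OF s(2)]
    and lim_t = uniform_limit_simple_approximation[OF t(2)]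
  obtain M where M: "\<And>x. x \<in> space per_borel \<Longrightarrow> cmod (\<phi> x) \<le> M"
    using bounded_borelE[OF assms(1)] by blast
  have s_bound: "cmod (s n x) \<le> M + 2" if "x \<in> space per_borel" for n x
  proof -
    have "2 / real (Suc n) \<le> 2"
      by (simp add: divide_le_eq)
    then show ?thesis
      using s(2)[of n x] M[OF that] norm_triangle_sub[of "s n x" "\<phi> x"] by linarith
  qed
  let ?v = "pvm_integral E \<psi> u" and ?vn = "\<lambda>n. pvm_simple_integral E (t n) u"
  have v: "?v \<in> H"
    using assms by (intro pvm_integral_mem)
  have vn: "?vn n \<in> H" for n
    using t(1) u by (rule simple_integral_mem)
  have "(\<lambda>n. pvm_simple_integral E (\<lambda>x. s n x * t n x) u) \<longlonglongrightarrow> pvm_integral E (\<lambda>x. \<phi> x * \<psi> x) u"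
    using assms(1,2) unfolding bounded_borel_def
    by (intro pvm_integral_tendsto simple_function_mult s t uniform_lim_mult lim_s lim_t u) auto
  moreover have "(\<lambda>n. pvm_simple_integral E (s n) (?vn n - ?v)) \<longlonglongrightarrow> 0"
  proof (rule Lim_null_comparison)
    show "\<forall>\<^sub>F n in sequentially. norm (pvm_simple_integral E (s n) (?vn n - ?v)) \<le> (M + 2) * norm (?vn n - ?v)"
      using norm_simple_integral_le[OF s(1) diff_mem[OF vn v]] s_bound by simp
    have "(\<lambda>n. ?vn n - ?v) \<longlonglongrightarrow> 0"
      using pvm_integral_tendsto[OF t(1) lim_t u] by (rule LIM_zero)
    then show "(\<lambda>n. (M + 2) * norm (?vn n - ?v)) \<longlonglongrightarrow> 0"
      by (intro tendsto_mult_right_zero tendsto_norm_zero)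
  qed
  moreover have "(\<lambda>n. pvm_simple_integral E (s n) ?v) \<longlonglongrightarrow> pvm_integral E \<phi> ?v"
    by (rule pvm_integral_tendsto[OF s(1) lim_s v])
  ultimately have "(\<lambda>n. pvm_simple_integral E (\<lambda>x. s n x * t n x) u) \<longlonglongrightarrow> pvm_integral E \<phi> ?v"
    using tendsto_add[of "\<lambda>n. pvm_simple_integral E (s n) (?vn n - ?v)" 0 sequentially
        "\<lambda>n. pvm_simple_integral E (s n) ?v" "pvm_integral E \<phi> ?v"]
    by (simp add: simple_integral_mult[OF s(1) t(1) u] simple_integral_diff_vector[OF s(1) vn v])
  then show ?thesis
    using \<open>(\<lambda>n. pvm_simple_integral E (\<lambda>x. s n x * t n x) u) \<longlonglongrightarrow> pvm_integral E (\<lambda>x. \<phi> x * \<psi> x) u\<close>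
    using LIMSEQ_unique by blast
qed

subsection \<open>Scalar spectral measures\<close>

lemma space_scalar_spectral_measure [simp]: "space (scalar_spectral_measure E u) = space per_borel"
  and sets_scalar_spectral_measure [simp]: "sets (scalar_spectral_measure E u) = sets per_borel"
  unfolding scalar_spectral_measure_def by (rule sets.space_measure_of_eq, rule sets.sets_measure_of_eq)

text \<open>\<open>scalar_spectral_measure\<close> has the values it is built from because \<open>cinner (E S u) u\<close> is countably
  additive in \<open>S\<close>, as \<open>E\<close> is, and nonnegative, being \<open>(norm (E S u))\<^sup>2\<close>.\<close>

lemma emeasure_scalar_spectral_measure:
  assumes "u \<in> H" and "S \<in> sets per_borel"
  shows "emeasure (scalar_spectral_measure E u) S = ennreal (Re (cinner (E S u) u))"
  unfolding scalar_spectral_measure_def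
proof (rule emeasure_measure_of_sigma[OF sets.sigma_algebra_axioms _ _ assms(2)])
  show "positive (sets per_borel) (\<lambda>S. ennreal (Re (cinner (E S u) u)))"
    using assms(1) by (simp add: positive_def E_empty)
  show "countably_additive (sets per_borel) (\<lambda>S. ennreal (Re (cinner (E S u) u)))"
  proof (rule countably_additiveI)
    fix A :: "nat \<Rightarrow> real set"
    assume A: "range A \<subseteq> sets per_borel" "disjoint_family A"
    have "(\<lambda>n. E (A n) u) sums E (\<Union>n. A n) u"
      using assms(1) A by (rule E_sums)
    then have "(\<lambda>n. cinner (E (A n) u) u) sums cinner (E (\<Union>n. A n) u) u"
      by (rule bounded_linear.sums[OF bounded_bilinear.bounded_linear_left[OF bounded_bilinear_cinner]])
    then have "(\<lambda>n. Re (cinner (E (A n) u) u)) sums Re (cinner (E (\<Union>n. A n) u) u)"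
      by (rule sums_Re)
    moreover have "Re (cinner (E (A n) u) u) \<ge> 0" for n
      using A(1) assms(1) by (subst cinner_E_self) auto
    ultimately show "(\<Sum>n. ennreal (Re (cinner (E (A n) u) u))) =
        ennreal (Re (cinner (E (\<Union> (range A)) u) u))"
      by (intro suminf_ennreal_eq)
  qed
qed

lemma finite_measure_scalar_spectral_measure:
  assumes "u \<in> H"
  shows "finite_measure (scalar_spectral_measure E u)"
  by (rule finite_measureI) (simp add: emeasure_scalar_spectral_measure[OF assms])

lemma simple_integral_scalar_spectral_measure:
  assumes s: "simple_function per_borel s" and "u \<in> H"
  shows "(LINT x|scalar_spectral_measure E u. s x) = cinner (pvm_simple_integral E s u) u"
proof -
  let ?m = "scalar_spectral_measure E u"
  interpret finite_measure ?m
    using assms(2) by (rule finite_measure_scalar_spectral_measure)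
  have "simple_function ?m s"
    using s by (simp add: simple_function_def)
  then have "Bochner_Integration.simple_bochner_integrable ?m s"
    by (simp add: simple_bochner_integrable.simps)
  then have "(LINT x|?m. s x) = Bochner_Integration.simple_bochner_integral ?m s"
    by (rule simple_bochner_integrable_eq_integral[symmetric])
  also have "\<dots> = (\<Sum>c\<in>s ` space per_borel. c * cinner (E (s -` {c} \<inter> space per_borel) u) u)"
    unfolding simple_bochner_integral_def
  proof (rule sum.cong)
    fix c
    let ?A = "s -` {c} \<inter> space per_borel"
    have "?A \<in> sets per_borel"
      using s by (rule simple_functionD(2))
    moreover have "{x \<in> space ?m. s x = c} = ?A"
      by auto
    ultimately have "complex_of_real (measure ?m {x \<in> space ?m. s x = c}) = cinner (E ?A u) u"
      using assms(2) by (simp add: measure_def emeasure_scalar_spectral_measure cinner_E_self)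
    then show "measure ?m {x \<in> space ?m. s x = c} *\<^sub>R c = c * cinner (E ?A u) u"
      by (simp add: scaleR_conv_of_real mult.commute)
  qed simp
  also have "\<dots> = cinner (pvm_simple_integral E s u) u"
    by (simp add: pvm_simple_integral_def cinner_sum_left cinner_scaleC_left)
  finally show ?thesis .
qed

lemma integral_scalar_spectral_measure:
  assumes "bounded_borel \<phi>" and u: "u \<in> H"
  shows "(LINT x|scalar_spectral_measure E u. \<phi> x) = cinner (pvm_integral E \<phi> u) u"
proof -
  let ?m = "scalar_spectral_measure E u"
  interpret finite_measure ?m
    using u by (rule finite_measure_scalar_spectral_measure)
  obtain s where s: "\<And>n. simple_function per_borel (s n)"
    "\<And>n x. cmod (s n x - \<phi> x) \<le> 2 / Suc n"
    using bounded_borel_simple_approximation[OF assms(1)] by blast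
  note lim = uniform_limit_simple_approximation[OF s(2)]
  obtain M where M: "\<And>x. x \<in> space per_borel \<Longrightarrow> cmod (\<phi> x) \<le> M"
    using bounded_borelE[OF assms(1)] by blast
  have "(\<lambda>n. LINT x|?m. s n x) \<longlonglongrightarrow> (LINT x|?m. \<phi> x)"
  proof (rule integral_dominated_convergence)
    show "\<phi> \<in> borel_measurable ?m"
      using assms(1) measurable_cong_sets[OF sets_scalar_spectral_measure refl]
      unfolding bounded_borel_def by blast
    show "s n \<in> borel_measurable ?m" for n
      using borel_measurable_simple_function[OF s(1)]
        measurable_cong_sets[OF sets_scalar_spectral_measure refl] by blast
    show "integrable ?m (\<lambda>_. M + 2)"
      by simp
    show "AE x in ?m. (\<lambda>n. s n x) \<longlonglongrightarrow> \<phi> x"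
      by (rule AE_I2, rule tendsto_uniform_limitI[OF lim UNIV_I])
    show "AE x in ?m. norm (s n x) \<le> M + 2" for n
    proof (rule AE_I2)
      fix x assume "x \<in> space ?m"
      moreover have "2 / real (Suc n) \<le> 2"
        by (simp add: divide_le_eq)
      ultimately show "cmod (s n x) \<le> M + 2"
        using s(2)[of n x] M[of x] norm_triangle_sub[of "s n x" "\<phi> x"] by simp
    qed
  qed
  moreover have "(\<lambda>n. LINT x|?m. s n x) \<longlonglongrightarrow> cinner (pvm_integral E \<phi> u) u"
    unfolding simple_integral_scalar_spectral_measure[OF s(1) u]
    by (intro tendsto_cinner tendsto_const pvm_integral_tendsto s(1) lim u)
  ultimately show ?thesis
    by (rule LIMSEQ_unique)
qed

end


section \<open>Convergence of the functional calculi\<close>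

locale pvm_approximation = pvm H E
  for H :: "'x::complex_hilbert_space set" and E :: "real set \<Rightarrow> 'x \<Rightarrow> 'x" +
  fixes Hn :: "nat \<Rightarrow> 'x set" and En :: "nat \<Rightarrow> real set \<Rightarrow> 'x \<Rightarrow> 'x" and Pn :: "nat \<Rightarrow> 'x \<Rightarrow> 'x"
  assumes pvm_n: "\<And>n. pvm (Hn n) (En n)"
    and Pn_mem: "\<And>n v. Pn n v \<in> Hn n"
    and Pn_tendsto: "\<And>g. g \<in> H \<Longrightarrow> (\<lambda>n. Pn n g) \<longlonglongrightarrow> g"
begin

text \<open>Functional calculus convergence for a single function. Bounded Borel functions instead of
  continuous periodic ones make the class of admissible functions visibly closed under the operations below.\<close>

definition calculus_converges :: "(real \<Rightarrow> complex) \<Rightarrow> bool" where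
  "calculus_converges \<phi> \<longleftrightarrow> bounded_borel \<phi> \<and>
     (\<forall>g\<in>H. (\<lambda>n. pvm_integral (En n) \<phi> (Pn n g)) \<longlonglongrightarrow> pvm_integral E \<phi> g)"

lemma calculus_converges_const: "calculus_converges (\<lambda>_. c)"
  using pvm.pvm_integral_const[OF pvm_n Pn_mem]
  by (simp add: calculus_converges_def bounded_borel_const pvm_integral_const tendsto_scaleC Pn_tendsto)

lemma calculus_converges_add:
  assumes "calculus_converges \<phi>" and "calculus_converges \<psi>"
  shows "calculus_converges (\<lambda>x. \<phi> x + \<psi> x)"
  using assms unfolding calculus_converges_def
  by (simp add: bounded_borel_add pvm_integral_add pvm.pvm_integral_add[OF pvm_n _ _ Pn_mem] tendsto_add)

text \<open>Replacing \<open>x\<^sub>n\<close> by \<open>P\<^sub>n y\<close> costs at most the supremum of \<open>\<phi>\<close>, which bounds the norms of all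
  the operators \<open>\<integral>\<phi> dE\<^sub>n\<close>, times the distance of \<open>x\<^sub>n\<close> from \<open>P\<^sub>n y\<close>.\<close>

lemma calculus_converges_along:
  assumes "calculus_converges \<phi>" and "y \<in> H" and x: "\<And>n. x n \<in> Hn n" and "x \<longlonglongrightarrow> y"
  shows "(\<lambda>n. pvm_integral (En n) \<phi> (x n)) \<longlonglongrightarrow> pvm_integral E \<phi> y"
proof -
  have \<phi>: "bounded_borel \<phi>"
    using assms(1) by (simp add: calculus_converges_def)
  then obtain M where M: "\<And>t. t \<in> space per_borel \<Longrightarrow> cmod (\<phi> t) \<le> M"
    using bounded_borelE by blast
  have "(\<lambda>n. pvm_integral (En n) \<phi> (x n - Pn n y)) \<longlonglongrightarrow> 0"
  proof (rule Lim_null_comparison)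
    show "\<forall>\<^sub>F n in sequentially. norm (pvm_integral (En n) \<phi> (x n - Pn n y)) \<le> M * norm (x n - Pn n y)"
      using pvm.norm_pvm_integral_le[OF pvm_n \<phi> pvm.diff_mem[OF pvm_n x Pn_mem] M] by simp
    have "(\<lambda>n. x n - Pn n y) \<longlonglongrightarrow> y - y"
      using assms by (intro tendsto_diff Pn_tendsto)
    then show "(\<lambda>n. M * norm (x n - Pn n y)) \<longlonglongrightarrow> 0"
      by (intro tendsto_mult_right_zero tendsto_norm_zero) simp
  qed
  moreover have "(\<lambda>n. pvm_integral (En n) \<phi> (Pn n y)) \<longlonglongrightarrow> pvm_integral E \<phi> y"
    using assms by (simp add: calculus_converges_def)
  ultimately show ?thesis
    using tendsto_add by (force simp: pvm.pvm_integral_diff_vector[OF pvm_n \<phi> x Pn_mem])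
qed

lemma calculus_converges_mult:
  assumes "calculus_converges \<phi>" and "calculus_converges \<psi>"
  shows "calculus_converges (\<lambda>x. \<phi> x * \<psi> x)"
proof -
  have b: "bounded_borel \<phi>" "bounded_borel \<psi>"
    using assms by (simp_all add: calculus_converges_def)
  have "(\<lambda>n. pvm_integral (En n) (\<lambda>x. \<phi> x * \<psi> x) (Pn n g)) \<longlonglongrightarrow> pvm_integral E (\<lambda>x. \<phi> x * \<psi> x) g"
    if "g \<in> H" for g
    unfolding pvm.pvm_integral_mult[OF pvm_n b Pn_mem] pvm_integral_mult[OF b that]
    using assms(2) that
    by (intro calculus_converges_along[OF assms(1)] pvm_integral_mem b
        pvm.pvm_integral_mem[OF pvm_n _ Pn_mem]) (simp_all add: calculus_converges_def)
  then show ?thesis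
    by (simp add: calculus_converges_def bounded_borel_mult b)
qed

text \<open>Put \<open>h = (\<integral>\<psi> dE) g\<close>, so that \<open>g = (\<integral>\<phi> dE) h\<close>. As \<open>\<integral>\<psi> dE\<^sub>n\<close> inverts \<open>\<integral>\<phi> dE\<^sub>n\<close>, it maps
  \<open>P\<^sub>n g - (\<integral>\<phi> dE\<^sub>n) P\<^sub>n h\<close>, which tends to \<open>0\<close>, to \<open>(\<integral>\<psi> dE\<^sub>n) P\<^sub>n g - P\<^sub>n h\<close>.\<close>

lemma calculus_converges_inverse:
  assumes "calculus_converges \<phi>" and \<psi>: "bounded_borel \<psi>" and inv: "\<And>x. \<psi> x * \<phi> x = 1"
  shows "calculus_converges \<psi>"
proof -
  obtain M where M: "\<And>x. x \<in> space per_borel \<Longrightarrow> cmod (\<psi> x) \<le> M"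
    using bounded_borelE[OF \<psi>] by blast
  have \<phi>: "bounded_borel \<phi>"
    using assms(1) by (simp add: calculus_converges_def)
  have "(\<lambda>n. pvm_integral (En n) \<psi> (Pn n g)) \<longlonglongrightarrow> pvm_integral E \<psi> g" if g: "g \<in> H" for g
  proof -
    define h where "h = pvm_integral E \<psi> g"
    have h: "h \<in> H"
      using \<psi> g by (simp add: h_def pvm_integral_mem)
    let ?k = "\<lambda>n. pvm_integral (En n) \<phi> (Pn n h)"
    have "pvm_integral E \<phi> h = pvm_integral E (\<lambda>x. \<phi> x * \<psi> x) g"
      unfolding h_def by (rule pvm_integral_mult[OF \<phi> \<psi> g, symmetric])
    then have "pvm_integral E \<phi> h = g"
      using inv by (simp add: mult.commute pvm_integral_const[OF g] scaleC_one)
    then have "?k \<longlonglongrightarrow> g"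
      using assms(1) h by (auto simp: calculus_converges_def)
    have k: "?k n \<in> Hn n" for n
      by (rule pvm.pvm_integral_mem[OF pvm_n \<phi> Pn_mem])
    have "pvm_integral (En n) \<psi> (?k n) = Pn n h" for n
      using pvm.pvm_integral_mult[OF pvm_n \<psi> \<phi> Pn_mem] pvm.pvm_integral_const[OF pvm_n Pn_mem, of n 1 h]
      by (simp add: inv scaleC_one)
    then have diff: "pvm_integral (En n) \<psi> (Pn n g) - Pn n h = pvm_integral (En n) \<psi> (Pn n g - ?k n)" for n
      by (simp add: pvm.pvm_integral_diff_vector[OF pvm_n \<psi> Pn_mem k])
    have "(\<lambda>n. pvm_integral (En n) \<psi> (Pn n g) - Pn n h) \<longlonglongrightarrow> 0"
    proof (rule Lim_null_comparison)
      show "\<forall>\<^sub>F n in sequentially. norm (pvm_integral (En n) \<psi> (Pn n g) - Pn n h) \<le> M * norm (Pn n g - ?k n)"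
        unfolding diff
        by (rule always_eventually, rule allI)
          (rule pvm.norm_pvm_integral_le[OF pvm_n \<psi> pvm.diff_mem[OF pvm_n Pn_mem k] M])
      have "(\<lambda>n. Pn n g - ?k n) \<longlonglongrightarrow> g - g"
        by (intro tendsto_diff Pn_tendsto g \<open>?k \<longlonglongrightarrow> g\<close>)
      then show "(\<lambda>n. M * norm (Pn n g - ?k n)) \<longlonglongrightarrow> 0"
        by (intro tendsto_mult_right_zero tendsto_norm_zero) simp
    qed
    from tendsto_add[OF this Pn_tendsto[OF h]] show ?thesis
      by (simp add: h_def)
  qed
  then show ?thesis
    by (simp add: calculus_converges_def \<psi>)
qed

lemma calculus_converges_uniform_closure:
  assumes \<phi>: "bounded_borel \<phi>"
    and approx: "\<And>e. e > 0 \<Longrightarrow>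
      \<exists>\<psi>. calculus_converges \<psi> \<and> (\<forall>x\<in>space per_borel. cmod (\<phi> x - \<psi> x) \<le> e)"
  shows "calculus_converges \<phi>"
proof -
  have "(\<lambda>n. pvm_integral (En n) \<phi> (Pn n g)) \<longlonglongrightarrow> pvm_integral E \<phi> g" if g: "g \<in> H" for g
  proof (rule tendstoI)
    fix e :: real assume "e > 0"
    define d where "d = e / (2 * (norm g + 1))"
    have "d > 0"
      using \<open>e > 0\<close> by (simp add: d_def add_nonneg_pos)
    have d_sum: "2 * d * (norm g + 1) = e"
      using add_nonneg_pos[OF norm_ge_zero[of g] zero_less_one] by (simp add: d_def field_simps)
    obtain \<psi> where conv: "calculus_converges \<psi>"
      and close: "\<And>x. x \<in> space per_borel \<Longrightarrow> cmod (\<phi> x - \<psi> x) \<le> d"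
      using approx[OF \<open>d > 0\<close>] by blast
    have \<psi>: "bounded_borel \<psi>"
      using conv by (simp add: calculus_converges_def)
    note \<delta> = bounded_borel_diff[OF \<phi> \<psi>]
    have split: "dist (pvm_integral E' \<phi> u) (pvm_integral E' \<psi> u) \<le> d * norm u"
      if "pvm H' E'" "u \<in> H'" for H' E' u
      using pvm.pvm_integral_add[OF that(1) \<psi> \<delta> that(2)]
        pvm.norm_pvm_integral_le[OF that(1) \<delta> that(2) close] by (simp add: dist_norm)
    let ?b = "\<lambda>n. d * norm (Pn n g) +
      dist (pvm_integral (En n) \<psi> (Pn n g)) (pvm_integral E \<psi> g) + d * norm g"
    have "dist (pvm_integral (En n) \<phi> (Pn n g)) (pvm_integral E \<phi> g) \<le> ?b n" for n
      using split[OF pvm_n Pn_mem, of n g] split[OF pvm_axioms g]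
        dist_triangle[of "pvm_integral (En n) \<phi> (Pn n g)" "pvm_integral E \<phi> g"
          "pvm_integral (En n) \<psi> (Pn n g)"]
        dist_triangle2[of "pvm_integral (En n) \<psi> (Pn n g)" "pvm_integral E \<phi> g" "pvm_integral E \<psi> g"]
      by linarith
    moreover have "\<forall>\<^sub>F n in sequentially. ?b n < e"
    proof (rule order_tendstoD(2))
      show "?b \<longlonglongrightarrow> d * norm g + 0 + d * norm g"
        using conv g unfolding calculus_converges_def
        by (intro tendsto_intros Pn_tendsto g tendsto_dist_iff[THEN iffD1]) blast
      show "d * norm g + 0 + d * norm g < e"
        using d_sum \<open>d > 0\<close> by (simp add: algebra_simps)
    qed
    ultimately show "\<forall>\<^sub>F n in sequentially.
        dist (pvm_integral (En n) \<phi> (Pn n g)) (pvm_integral E \<phi> g) < e"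
      by (auto elim!: eventually_mono intro: le_less_trans)
  qed
  then show ?thesis
    by (simp add: calculus_converges_def \<phi>)
qed

text \<open>A periodic function is a function of \<open>cis \<theta>\<close>, and by the Stone-Weierstrass theorem a continuous
  function on the circle is a uniform limit of polynomials in \<open>cos \<theta>\<close> and \<open>sin \<theta>\<close>. Those are
  obtained from \<open>cis \<theta>\<close> and its inverse by addition and multiplication.\<close>

lemma calculus_converges_per_continuous:
  assumes cis: "calculus_converges cis" and \<phi>: "per_continuous \<phi>"
  shows "calculus_converges \<phi>"
proof (rule calculus_converges_uniform_closure[OF bounded_borel_per_continuous[OF \<phi>]])
  have "per_continuous (\<lambda>x. cis (- x))"
    by (simp add: per_continuous_def continuous_intros cis_minus_pi cis_pi)
  then have cis': "calculus_converges (\<lambda>x. cis (- x))"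
    by (intro calculus_converges_inverse[OF cis] bounded_borel_per_continuous)
      (simp_all add: cis_mult)
  have Re_cis: "calculus_converges (\<lambda>x. complex_of_real (Re (cis x)))"
    using calculus_converges_mult[OF calculus_converges_const[of "1/2"] calculus_converges_add[OF cis cis']]
    by (rule back_subst[of calculus_converges]) (simp add: fun_eq_iff complex_eq_iff)
  have Im_cis: "calculus_converges (\<lambda>x. complex_of_real (Im (cis x)))"
    using calculus_converges_mult[OF calculus_converges_const[of "-\<i>/2"] calculus_converges_add[OF cis
        calculus_converges_mult[OF calculus_converges_const[of "-1"] cis']]]
    by (rule back_subst[of calculus_converges]) (simp add: fun_eq_iff complex_eq_iff)
  have real_poly: "calculus_converges (\<lambda>x. complex_of_real (p (cis x)))"
    if "real_polynomial_function p" for p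
    using that
  proof (induction rule: real_polynomial_function.induct)
    case (linear f)
    have f_eq: "f z = f 1 * Re z + f \<i> * Im z" for z
    proof -
      have "z = Re z *\<^sub>R 1 + Im z *\<^sub>R \<i>"
        by (simp add: complex_eq_iff)
      then have "f z = f (Re z *\<^sub>R 1 + Im z *\<^sub>R \<i>)"
        by simp
      also have "\<dots> = Re z * f 1 + Im z * f \<i>"
        using bounded_linear.linear[OF linear]
        by (simp only: linear_add linear_cmul real_scaleR_def)
      finally show ?thesis
        by (simp add: mult.commute)
    qed
    have "(\<lambda>x. complex_of_real (f (cis x))) =
        (\<lambda>x. complex_of_real (f 1) * complex_of_real (Re (cis x)) +
          complex_of_real (f \<i>) * complex_of_real (Im (cis x)))"
      by (rule ext, subst f_eq) simp
    then show ?case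
      by (simp only:) (intro calculus_converges_add calculus_converges_mult
          calculus_converges_const Re_cis Im_cis)
  qed (simp_all add: calculus_converges_const calculus_converges_add calculus_converges_mult)
  \<comment> \<open>\<open>Arg\<close> jumps at \<open>-1\<close>, but \<open>\<phi>\<close> takes the same value at both ends of the jump. Continuity of \<open>f\<close> follows
    because \<open>cis\<close> is a closed map from the compact interval onto the circle.\<close>
  define f where "f z = \<phi> (Arg z)" for z
  have f_cis: "f (cis x) = \<phi> x" if "x \<in> {-pi..pi}" for x
  proof (cases "x = -pi")
    case True
    then have "cis x = cis pi"
      by (simp add: cis_minus_pi)
    moreover have "Arg (cis pi) = pi"
      by (rule Arg_cis) simp
    ultimately have "f (cis x) = \<phi> pi"
      unfolding f_def by (simp only:)
    then show ?thesis
      using \<phi> True by (simp add: per_continuous_def)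
  next
    case False
    then show ?thesis
      using that by (simp add: f_def Arg_cis)
  qed
  have "continuous_on (sphere 0 1) f"
    unfolding continuous_on_closed_vimage[OF closed_sphere]
  proof (intro allI impI)
    fix C :: "complex set" assume "closed C"
    have "f -` C \<inter> sphere 0 1 = cis ` (\<phi> -` C \<inter> {-pi..pi})"
    proof safe
      fix z :: complex assume z: "f z \<in> C" "z \<in> sphere 0 1"
      then have "z = cis (Arg z)"
        by (cases "z = 0") (simp_all add: cis_Arg sgn_div_norm)
      moreover have "Arg z \<in> \<phi> -` C \<inter> {-pi..pi}"
        using z Arg_bounded[of z] by (simp add: f_def)
      ultimately show "z \<in> cis ` (\<phi> -` C \<inter> {-pi..pi})"
        by blast
    qed (simp_all add: f_cis)
    moreover have "closed (\<phi> -` C \<inter> {-pi..pi})"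
      using \<phi> \<open>closed C\<close> continuous_on_closed_vimage[of "{-pi..pi}" \<phi>]
      by (simp add: per_continuous_def)
    then have "compact (\<phi> -` C \<inter> {-pi..pi})"
      by (simp add: compact_eq_bounded_closed bounded_Int)
    then have "compact (cis ` (\<phi> -` C \<inter> {-pi..pi}))"
      by (intro compact_continuous_image continuous_intros)
    ultimately show "closed (f -` C \<inter> sphere 0 1)"
      by (simp add: compact_imp_closed)
  qed
  fix e :: real assume "e > 0"
  obtain p where "polynomial_function p" and p: "\<And>z. z \<in> sphere 0 1 \<Longrightarrow> norm (f z - p z) < e"
    using Stone_Weierstrass_polynomial_function[OF compact_sphere \<open>continuous_on (sphere 0 1) f\<close> \<open>e > 0\<close>]
    by blast
  then have "real_polynomial_function (\<lambda>z. Re (p z))" "real_polynomial_function (\<lambda>z. Im (p z))"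
    using bounded_linear_Re bounded_linear_Im unfolding polynomial_function_def comp_def by blast+
  then have "calculus_converges (\<lambda>x. complex_of_real (Re (p (cis x))) + \<i> * complex_of_real (Im (p (cis x))))"
    by (intro calculus_converges_add calculus_converges_mult calculus_converges_const real_poly)
  then have "calculus_converges (\<lambda>x. p (cis x))"
    by (simp flip: complex_eq)
  moreover have "cmod (\<phi> x - p (cis x)) \<le> e" if "x \<in> space per_borel" for x
    using p[of "cis x"] f_cis[of x] that by (simp add: space_per_borel)
  ultimately show "\<exists>\<psi>. calculus_converges \<psi> \<and> (\<forall>x\<in>space per_borel. cmod (\<phi> x - \<psi> x) \<le> e)"
    by blast
qed

lemma scalar_spectral_measures_converge:
  assumes conv: "\<And>\<phi>. per_continuous \<phi> \<Longrightarrow> calculus_converges \<phi>" and g: "g \<in> H" "norm g = 1"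
  shows "per_weakly_converges
    (\<lambda>n. scalar_spectral_measure (En n) ((1 / norm (Pn n g)) *\<^sub>R Pn n g)) (scalar_spectral_measure E g)"
  unfolding per_weakly_converges_def
proof (intro allI impI)
  fix \<phi> assume "per_continuous \<phi>"
  then have \<phi>: "bounded_borel \<phi>"
    by (rule bounded_borel_per_continuous)
  \<comment> \<open>For the finitely many \<open>n\<close> with \<open>Pn n g = 0\<close> this is \<open>0\<close>, which lies in \<open>Hn n\<close> as well.\<close>
  define u where "u n = (1 / norm (Pn n g)) *\<^sub>R Pn n g" for n
  have u: "u n \<in> Hn n" for n
    unfolding u_def scaleR_scaleC by (rule pvm.scaleC_mem[OF pvm_n Pn_mem])
  have "u \<longlonglongrightarrow> (1 / norm g) *\<^sub>R g"
    unfolding u_def using g by (intro tendsto_intros Pn_tendsto) auto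
  then have "u \<longlonglongrightarrow> g"
    using g by simp
  then have "(\<lambda>n. cinner (pvm_integral (En n) \<phi> (u n)) (u n)) \<longlonglongrightarrow> cinner (pvm_integral E \<phi> g) g"
    using conv[OF \<open>per_continuous \<phi>\<close>] g u by (intro tendsto_cinner calculus_converges_along)
  then show "(\<lambda>n. LINT \<theta>|scalar_spectral_measure (En n) ((1 / norm (Pn n g)) *\<^sub>R Pn n g). \<phi> \<theta>)
      \<longlonglongrightarrow> (LINT \<theta>|scalar_spectral_measure E g. \<phi> \<theta>)"
    unfolding u_def[symmetric] pvm.integral_scalar_spectral_measure[OF pvm_n \<phi> u]
      integral_scalar_spectral_measure[OF \<phi> g(1)] .
qed

end

theorem theorem4p5:
  fixes \<Omega> :: "(real ^ 'd) set"
    and \<omega> :: "(real ^ 'd) measure"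
    and F :: "real ^ 'd \<Rightarrow> real ^ 'd"
    and J :: "(real ^ 'd \<Rightarrow> complex) \<Rightarrow> 'x::complex_hilbert_space"
    and H :: "'x set" and Hn :: "nat \<Rightarrow> 'x set"
    and P :: "'x \<Rightarrow> 'x" and Pn :: "nat \<Rightarrow> 'x \<Rightarrow> 'x"
    and K :: "'x \<Rightarrow> 'x" and Kn :: "nat \<Rightarrow> 'x \<Rightarrow> 'x"
    and E :: "real set \<Rightarrow> 'x \<Rightarrow> 'x" and En :: "nat \<Rightarrow> real set \<Rightarrow> 'x \<Rightarrow> 'x"
  assumes "space \<omega> = \<Omega>" and "F \<in> \<Omega> \<rightarrow> \<Omega>"
    and "L2_inclusion \<omega> J" and "H = J ` square_integrable \<omega>"
    and "closed_csubspace H"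
    and "\<And>n. closed_csubspace (Hn n)" and "\<And>n. finite_dimensional (Hn n)"
    and "orthogonal_projection H P" and "\<And>n. orthogonal_projection (Hn n) (Pn n)"
    and "\<And>v. (\<lambda>n. Pn n v) \<longlonglongrightarrow> P v"
    and "koopman_operator \<omega> J F K"
    and "unitary_on H K" and "\<And>n. unitary_on (Hn n) (Kn n)"
    and "\<And>v w. (\<lambda>n. cinner (Kn n (Pn n v)) w) \<longlonglongrightarrow> cinner (K (P v)) w"
    and "spectral_pvm H K E" and "\<And>n. spectral_pvm (Hn n) (Kn n) (En n)"
  shows "(\<forall>g\<in>H. norm g = 1 \<longrightarrow>
            per_weakly_converges
              (\<lambda>n. scalar_spectral_measure (En n) ((1 / norm (Pn n g)) *\<^sub>R Pn n g))
              (scalar_spectral_measure E g))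
         \<and> functional_calculus_converges H Pn En E"
proof -
  interpret pvm H E
    using assms(5,15) by unfold_locales (simp_all add: spectral_pvm_def)
  have fix_P: "P g = g" if "g \<in> H" for g
    using orthogonal_projection_fixes[OF assms(8) csubspace that] .
  interpret pvm_approximation H E Hn En Pn
  proof (intro pvm_approximation.intro pvm_approximation_axioms.intro)
    show "pvm H E"
      by (rule pvm_axioms)
    show "pvm (Hn n) (En n)" for n
      using assms(6,16)[of n] by unfold_locales (simp_all add: spectral_pvm_def)
    show "Pn n v \<in> Hn n" for n v
      using assms(9)[of n] by (simp add: orthogonal_projection_def)
    show "(\<lambda>n. Pn n g) \<longlonglongrightarrow> g" if "g \<in> H" for g
      using assms(10)[of g] fix_P[OF that] by simp
  qed
  have cis: "pvm_integral E cis u = K u" if "u \<in> H" for u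
    using assms(15) that by (simp add: spectral_pvm_def flip: cis_conv_exp)
  have cis_n: "pvm_integral (En n) cis u = Kn n u" if "u \<in> Hn n" for n u
    using assms(16)[of n] that by (simp add: spectral_pvm_def flip: cis_conv_exp)
  have "calculus_converges cis"
    unfolding calculus_converges_def
  proof (intro conjI ballI)
    show "bounded_borel cis"
      by (rule bounded_borel_per_continuous)
        (simp add: per_continuous_def continuous_intros cis_minus_pi cis_pi)
    fix g assume g: "g \<in> H"
    have "(\<lambda>n. Kn n (Pn n g)) \<longlonglongrightarrow> K g"
    proof (rule tendsto_of_weak_of_norm)
      show "(\<lambda>n. cinner (Kn n (Pn n g)) (K g)) \<longlonglongrightarrow> cinner (K g) (K g)"
        using assms(14)[of g "K g"] fix_P[OF g] by simp
      show "(\<lambda>n. norm (Kn n (Pn n g))) \<longlonglongrightarrow> norm (K g)"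
        unfolding unitary_on_isometry[OF assms(13) Pn_mem] unitary_on_isometry[OF assms(12) g]
        using g by (intro tendsto_norm Pn_tendsto)
    qed
    then show "(\<lambda>n. pvm_integral (En n) cis (Pn n g)) \<longlonglongrightarrow> pvm_integral E cis g"
      by (simp add: cis[OF g] cis_n[OF Pn_mem])
  qed
  then have conv: "calculus_converges \<phi>" if "per_continuous \<phi>" for \<phi>
    using that by (rule calculus_converges_per_continuous)
  show ?thesis
    using scalar_spectral_measures_converge[OF conv] conv
    by (simp add: functional_calculus_converges_def calculus_converges_def)
qed

end
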